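(* If $S_{\boldsymbol\lambda}\in\boldsymbol B(\ell^2(V))$ is a weighted shift on a directed tree $\mathcal T=(V,E)$ with weights $\boldsymbol\lambda=\{\lambda_v\}_{v\in V^\circ}$, then the following conditions are equivalent: (i) $S_{\boldsymbol\lambda}$ is completely hyperexpansive; (ii) $\big\{\sum_{v\in\operatorname{Chi}^{\langle n\rangle}(u)}|\lambda_{u\mid v}|^2\big\}_{n=0}^\infty$ is a completely alternating sequence for all $u\in V$; (iii) $\{\|S_{\boldsymbol\lambda}^ne_u\|^2\}_{n=0}^\infty$ is a completely alternating sequence for all $u\in V$; (iv) $\sum_{j=0}^n(-1)^j\binom nj\|S_{\boldsymbol\lambda}^je_u\|^2\le0$ for all $n\in\{1,2,\dots\}$ and $u\in V$.
   Context: A directed tree $\mathcal T=(V,E)$ consists of a nonempty set $V$ (of arbitrary cardinality) of vertices and a set $E\subseteq V\times V\setminus\{(v,v):v\in V\}$ of edges such that: (1) any two distinct vertices $u,v$ are joined by an undirected path, i.e. there are $v_1=u,\dots,v_n=v$ in $V$ ($n\ge 2$) with $(v_j,v_{j+1})\in E$ or $(v_{j+1},v_j)\in E$ for each $j<n$; (2) there is no circuit, i.e. no finite sequence of distinct vertices $u_1,\dots,u_n$ ($n\ge2$) with $(u_j,u_{j+1})\in E$ for $j<n$ and $(u_n,u_1)\in E$; (3) every vertex $v$ that is not a root has a unique vertex $\operatorname{par}(v)$ (its parent) with $(\operatorname{par}(v),v)\in E$; a root is a vertex $v$ for which there is no $u$ with $(u,v)\in E$. A directed tree has at most one root, denoted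 $\mathrm{root}$ when it exists. $V^\circ$ is $V$ with the root removed (and $V^\circ=V$ if $\mathcal T$ has no root). $\operatorname{Chi}(u)=\{v\in V:(u,v)\in E\}$; $\operatorname{Chi}^{\langle0\rangle}(u)=\{u\}$ and $\operatorname{Chi}^{\langle n+1\rangle}(u)=\bigcup_{v\in\operatorname{Chi}^{\langle n\rangle}(u)}\operatorname{Chi}(v)$ (these sets are pairwise disjoint in $n$). $\operatorname{par}^j$ is the $j$-fold composition of $\operatorname{par}$, $\operatorname{par}^0$ being the identity. $\ell^2(V)$ is the Hilbert space of square summable complex functions on $V$, with orthonormal basis $\{e_u\}_{u\in V}$, $e_u$ being the indicator function of $\{u\}$. For $\boldsymbol\lambda=\{\lambda_v\}_{v\in V^\circ}\subseteq\mathbb C$ and $f\colon V\to\mathbb C$ put $(\Lambda f)(v)=\lambda_v f(\operatorname{par}(v))$ for $v\in V^\circ$ and $(\Lambda f)(\mathrm{root})=0$. The weighted shift $S_{\boldsymbol\lambda}$ is the operator in $\ell^2(V)$ with domain $\{f\in\ell^2(V):\Lambda f\in\ell^2(V)\}$ and $S_{\boldsymbol\lambda}f=\Lambda f$. $\boldsymbol B(\mathcal H)$ denotes the bounded operators on $\mathcal H$ with domain $\mathcal H$. For $u\in V$ put $\lambda_{u\mid u}=1$ and $\lambda_{u\mid v}=\prod_{j=0}^{n-1}\lambda_{\operatorname{par}^j(v)}$ if $v\in\operatorname{Chi}^{\langle n\rangle}(u)$, $n\ge1$. A real sequence $\{a_n\}_{n=0}^\infty$ is completely alternating if $\sum_{j=0}^n(-1)^j\binom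 nja_{m+j}\le0$ for all integers $m\ge0$ and $n\ge1$. $A\in\boldsymbol B(\mathcal H)$ is completely hyperexpansive if $\{\|A^nh\|^2\}_{n=0}^\infty$ is completely alternating for every $h\in\mathcal H$. *)

theory Defs
  imports "HOL-Analysis.Analysis"
begin

section \<open>Directed trees\<close>

definition is_root :: "'v set \<Rightarrow> ('v \<times> 'v) set \<Rightarrow> 'v \<Rightarrow> bool" where
  "is_root V E v \<longleftrightarrow> v \<in> V \<and> (\<nexists>u. (u, v) \<in> E)"

text \<open>In \<open>connected\<close> and \<open>no_circuit\<close> a finite sequence of vertices is a list.\<close>

locale directed_tree =
  fixes V :: "'v set" and E :: "('v \<times> 'v) set"
  assumes nonempty: "V \<noteq> {}"
    and edges: "E \<subseteq> V \<times> V - {(v, v) | v. v \<in> V}"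
    and connected: "\<And>u v. u \<in> V \<Longrightarrow> v \<in> V \<Longrightarrow> u \<noteq> v \<Longrightarrow>
      \<exists>p. length p \<ge> 2 \<and> set p \<subseteq> V \<and> hd p = u \<and> last p = v \<and>
          successively (\<lambda>x y. (x, y) \<in> E \<or> (y, x) \<in> E) p"
    and no_circuit: "\<not> (\<exists>p. length p \<ge> 2 \<and> set p \<subseteq> V \<and> distinct p \<and>
          successively (\<lambda>x y. (x, y) \<in> E) p \<and> (last p, hd p) \<in> E)"
    and unique_parent: "\<And>v. v \<in> V \<Longrightarrow> \<not> is_root V E v \<Longrightarrow> \<exists>!u. (u, v) \<in> E"

definition nonroots :: "'v set \<Rightarrow> ('v \<times> 'v) set \<Rightarrow> 'v set" where
  "nonroots V E = V - {v. is_root V E v}"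

text \<open>Meaningful only at non-root vertices.\<close>

definition par :: "('v \<times> 'v) set \<Rightarrow> 'v \<Rightarrow> 'v" where
  "par E v = (THE u. (u, v) \<in> E)"

definition Chi :: "('v \<times> 'v) set \<Rightarrow> 'v \<Rightarrow> 'v set" where
  "Chi E u = {v. (u, v) \<in> E}"

primrec Chi_n :: "('v \<times> 'v) set \<Rightarrow> nat \<Rightarrow> 'v \<Rightarrow> 'v set" where
  "Chi_n E 0 u = {u}"
| "Chi_n E (Suc n) u = (\<Union>v \<in> Chi_n E n u. Chi E v)"

text \<open>The weight \<open>\<lambda>\<^bsub>u|v\<^esub>\<close>. It is meaningful only if \<open>v\<close> is a descendant of \<open>u\<close>; in a directed
  tree the sets \<open>Chi_n E n u\<close> are pairwise disjoint in \<open>n\<close>, so the generation of \<open>v\<close> below \<open>u\<close> is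
  then unique. For \<open>v = u\<close> the product is empty.\<close>

definition path_weight :: "('v \<times> 'v) set \<Rightarrow> ('v \<Rightarrow> complex) \<Rightarrow> 'v \<Rightarrow> 'v \<Rightarrow> complex" where
  "path_weight E lam u v =
     (let n = (THE n. v \<in> Chi_n E n u) in \<Prod>j<n. lam ((par E ^^ j) v))"


section \<open>The space \<open>\<ell>\<^sup>2(V)\<close> and operators in it\<close>

text \<open>A function on the vertex set \<open>V\<close> is represented by its extension by zero to the ambient type.\<close>

definition ell2 :: "'v set \<Rightarrow> ('v \<Rightarrow> complex) set" where
  "ell2 V = {f. (\<forall>v. v \<notin> V \<longrightarrow> f v = 0) \<and> (\<lambda>v. (cmod (f v))\<^sup>2) summable_on V}"

definition ell2_norm :: "'v set \<Rightarrow> ('v \<Rightarrow> complex) \<Rightarrow> real" where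
  "ell2_norm V f = sqrt (\<Sum>\<^sub>\<infinity>v\<in>V. (cmod (f v))\<^sup>2)"

abbreviation basis_vec :: "'v \<Rightarrow> 'v \<Rightarrow> complex" where
  "basis_vec u \<equiv> indicator {u}"

text \<open>An operator in \<open>\<ell>\<^sup>2(V)\<close> is a pair of its domain and a map whose values outside
  the domain are irrelevant.\<close>

type_synonym 'v operator = "('v \<Rightarrow> complex) set \<times> (('v \<Rightarrow> complex) \<Rightarrow> ('v \<Rightarrow> complex))"

definition bounded_ops :: "'v set \<Rightarrow> 'v operator set" where
  "bounded_ops V = {(D, A). D = ell2 V \<and>
     (\<forall>f\<in>D. A f \<in> ell2 V) \<and>
     (\<forall>f\<in>D. \<forall>g\<in>D. A (\<lambda>v. f v + g v) = (\<lambda>v. A f v + A g v)) \<and>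
     (\<forall>c. \<forall>f\<in>D. A (\<lambda>v. c * f v) = (\<lambda>v. c * A f v)) \<and>
     (\<exists>C. \<forall>f\<in>D. ell2_norm V (A f) \<le> C * ell2_norm V f)}"

text \<open>Application of the \<open>n\<close>-th power; used only for operators in \<open>bounded_ops V\<close>, where
  all powers have domain \<open>ell2 V\<close>.\<close>

definition op_power :: "'v operator \<Rightarrow> nat \<Rightarrow> ('v \<Rightarrow> complex) \<Rightarrow> ('v \<Rightarrow> complex)" where
  "op_power A n = snd A ^^ n"


section \<open>Weighted shifts\<close>

text \<open>Only the values of \<open>lam\<close> on \<open>nonroots V E\<close> matter.\<close>

definition shift_map ::
  "'v set \<Rightarrow> ('v \<times> 'v) set \<Rightarrow> ('v \<Rightarrow> complex) \<Rightarrow> ('v \<Rightarrow> complex) \<Rightarrow> ('v \<Rightarrow> complex)" where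
  "shift_map V E lam f = (\<lambda>v. if v \<in> nonroots V E then lam v * f (par E v) else 0)"

definition weighted_shift ::
  "'v set \<Rightarrow> ('v \<times> 'v) set \<Rightarrow> ('v \<Rightarrow> complex) \<Rightarrow> 'v operator" where
  "weighted_shift V E lam = ({f \<in> ell2 V. shift_map V E lam f \<in> ell2 V}, shift_map V E lam)"


section \<open>Complete hyperexpansivity\<close>

definition completely_alternating :: "(nat \<Rightarrow> real) \<Rightarrow> bool" where
  "completely_alternating a \<longleftrightarrow>
     (\<forall>m. \<forall>n\<ge>1. (\<Sum>j=0..n. (-1) ^ j * real (n choose j) * a (m + j)) \<le> 0)"

definition completely_hyperexpansive :: "'v set \<Rightarrow> 'v operator \<Rightarrow> bool" where
  "completely_hyperexpansive V A \<longleftrightarrow> A \<in> bounded_ops V \<and>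
     (\<forall>h \<in> ell2 V. completely_alternating (\<lambda>n. (ell2_norm V (op_power A n h))\<^sup>2))"

end

theory Submission
  imports Defs
begin

text \<open>
  The power \<open>S\<^sup>n\<close> multiplies by a weight and composes with the \<open>n\<close>-th ancestor map, so the vectors
  \<open>S\<^sup>n e\<^sub>u\<close> have disjoint supports for different \<open>u\<close> and
  \<open>\<parallel>S\<^sup>n f\<parallel>\<^sup>2 = \<Sum>\<^sub>u \<bar>f u\<bar>\<^sup>2 \<parallel>S\<^sup>n e\<^sub>u\<parallel>\<^sup>2\<close>. Hence the inequalities in (iv) carry over from basis vectors to all
  \<open>f\<close>, and taking \<open>f = S\<^sup>m h\<close> supplies the index shift in the definition of complete alternation.
\<close>

lemma completely_alternating_0:
  assumes "completely_alternating a" "n \<ge> 1"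
  shows "(\<Sum>j=0..n. (-1) ^ j * real (n choose j) * a j) \<le> 0"
  using assms(1)[unfolded completely_alternating_def, rule_format, OF assms(2), of 0] by simp

section \<open>Ancestors, generations and the weights along ancestor lines\<close>

context directed_tree
begin

lemma edge_parent:
  assumes "(u, v) \<in> E"
  shows "v \<in> nonroots V E" "par E v = u"
proof -
  have v: "v \<in> V" "\<not> is_root V E v" using assms edges by (auto simp: is_root_def)
  then show "v \<in> nonroots V E" by (simp add: nonroots_def)
  show "par E v = u"
    unfolding par_def using unique_parent[OF v] assms by (auto intro: the1_equality)
qed

lemma parent_edge:
  assumes "v \<in> nonroots V E"
  shows "(par E v, v) \<in> E"
  using assms edge_parent by (fastforce simp: nonroots_def is_root_def)

lemma Chi_iff: "v \<in> Chi E u \<longleftrightarrow> v \<in> nonroots V E \<and> par E v = u"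
  using edge_parent parent_edge by (auto simp: Chi_def)

text \<open>Reading generations upwards replaces unions of children by iterates of
  \<open>par E\<close>. As \<open>par E\<close> is meaningful only at non-roots, every ancestor
  before the \<open>n\<close>-th has to be a non-root.\<close>

lemma Chi_n_iff:
  "v \<in> Chi_n E n u \<longleftrightarrow> (\<forall>i<n. (par E ^^ i) v \<in> nonroots V E) \<and> (par E ^^ n) v = u"
proof (induction n arbitrary: v)
  case (Suc n)
  show ?case
    by (auto simp: Suc Chi_iff All_less_Suc2 funpow_swap1)
qed auto

lemma par_in_V: "v \<in> nonroots V E \<Longrightarrow> par E v \<in> V"
  using parent_edge edges by fastforce

lemma Chi_n_subset_V: "u \<in> V \<Longrightarrow> Chi_n E n u \<subseteq> V"
  using edges by (induction n) (auto simp: Chi_def)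

lemma Chi_n_ancestor_in_V: "v \<in> Chi_n E n u \<Longrightarrow> v \<in> V \<Longrightarrow> u \<in> V"
  by (cases n) (auto simp: Chi_n_iff par_in_V simp del: Chi_n.simps)

text \<open>A vertex below itself lies on a closed ancestor line, and a shortest such line is a
  circuit.\<close>

lemma not_own_descendant:
  assumes "u \<in> V" "k > 0"
  shows "u \<notin> Chi_n E k u"
proof
  assume "u \<in> Chi_n E k u"
  define m where "m = (LEAST k. k > 0 \<and> u \<in> Chi_n E k u)"
  have m: "m > 0" "u \<in> Chi_n E m u"
    using LeastI[of "\<lambda>k. k > 0 \<and> u \<in> Chi_n E k u" k] assms(2) \<open>u \<in> Chi_n E k u\<close>
    by (auto simp: m_def)
  have minimal: "u \<notin> Chi_n E i u" if "0 < i" "i < m" for i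
    using that not_less_Least[of i "\<lambda>k. k > 0 \<and> u \<in> Chi_n E k u"] by (auto simp: m_def)
  have nonroot: "(par E ^^ i) u \<in> nonroots V E" if "i < m" for i
    using m that by (simp add: Chi_n_iff)
  have period: "(par E ^^ m) u = u"
    using m by (simp add: Chi_n_iff)
  \<comment> \<open>The case \<open>i = m\<close> reduces to \<open>i = 0\<close>, since the
    \<open>m\<close>-th ancestor is \<open>u\<close> again.\<close>
  have nonroot': "(par E ^^ i) u \<in> nonroots V E" if "i \<le> m" for i
    using nonroot[of i] nonroot[of 0] period m that by (cases "i = m") auto
  have step: "((par E ^^ Suc i) u, (par E ^^ i) u) \<in> E" if "i \<le> m" for i
    using parent_edge[OF nonroot'[OF that]] by simp
  \<comment> \<open>Edges point from parent to child, so the line is listed downwards: from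
    \<open>u\<close>, as its own \<open>m\<close>-th ancestor, to the parent of \<open>u\<close>.
    The edge from that parent to \<open>u\<close> closes the circuit.\<close>
  define p where "p = map (\<lambda>i. (par E ^^ (m - i)) u) [0..<m]"
  \<comment> \<open>Period 1 would make \<open>(u, u)\<close> an edge, and loops are
    excluded.\<close>
  have "m \<noteq> 1"
    using step[of 0] period edges assms by (auto simp: numeral_eq_Suc)
  then have "length p \<ge> 2" using m by (simp add: p_def)
  moreover have "set p \<subseteq> V"
    using nonroot' by (auto simp: p_def nonroots_def)
  moreover have "distinct p"
  proof -
    have ne: "(par E ^^ i) u \<noteq> (par E ^^ j) u" if "0 < i" "i < j" "j \<le> m" for i j
    proof
      assume eq: "(par E ^^ i) u = (par E ^^ j) u"
      \<comment> \<open>Cutting out the segment between two equal ancestors leaves a shorter period,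
        against the minimality of \<open>m\<close>.\<close>
      have "(par E ^^ (m - j + i)) u = (par E ^^ (m - j)) ((par E ^^ i) u)"
        by (simp add: funpow_add)
      also have "\<dots> = (par E ^^ m) u"
        using that by (simp add: eq flip: funpow_add[unfolded o_def, THEN fun_cong])
      finally have "u \<in> Chi_n E (m - j + i) u"
        using that nonroot period by (auto simp: Chi_n_iff)
      moreover have "0 < m - j + i" "m - j + i < m" using that by auto
      ultimately show False using minimal[of "m - j + i"] by (simp only: simp_thms)
    qed
    have "inj_on (\<lambda>i. (par E ^^ (m - i)) u) {0..<m}"
    proof (rule linorder_inj_onI')
      fix i j assume "i \<in> {0..<m}" "j \<in> {0..<m}" "i < j"
      then have "0 < m - j" "m - j < m - i" "m - i \<le> m" by auto
      from ne[OF this] show "(par E ^^ (m - i)) u \<noteq> (par E ^^ (m - j)) u" by simp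
    qed
    then show ?thesis by (simp add: p_def distinct_map)
  qed
  moreover have "successively (\<lambda>x y. (x, y) \<in> E) p"
  proof -
    have "((par E ^^ (m - i)) u, (par E ^^ (m - Suc i)) u) \<in> E" if "Suc i < m" for i
      using step[of "m - Suc i"] that by (simp add: Suc_diff_Suc del: funpow.simps)
    then show ?thesis by (simp add: p_def successively_conv_nth)
  qed
  moreover have "(last p, hd p) \<in> E"
    using step[of 0] period m by (simp add: p_def last_map hd_map)
  ultimately show False using no_circuit[unfolded not_ex, rule_format, of p] by blast
qed

text \<open>If going up from \<open>v\<close> met \<open>u\<close> after \<open>i\<close> steps and
  again after \<open>j > i\<close> steps, \<open>u\<close> would be its own descendant. This makes
  the \<open>THE\<close> in \<open>path_weight\<close> well defined.\<close>

lemma generation_unique: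
  assumes "u \<in> V" "v \<in> Chi_n E n u" "v \<in> Chi_n E k u"
  shows "n = k"
proof -
  have "\<not> i < j" if "v \<in> Chi_n E i u" "v \<in> Chi_n E j u" for i j
  proof
    assume "i < j"
    have shift: "(par E ^^ l) u = (par E ^^ (l + i)) v" for l
      using that(1) by (simp add: Chi_n_iff funpow_add)
    have "u \<in> Chi_n E (j - i) u"
      using that(2) \<open>i < j\<close> by (simp add: Chi_n_iff shift)
    then show False using not_own_descendant[of u "j - i"] assms(1) \<open>i < j\<close> by simp
  qed
  then show ?thesis using assms by (meson nat_neq_iff)
qed

text \<open>The path weight from the \<open>n\<close>-th ancestor of \<open>v\<close> down to
  \<open>v\<close>, indexed by \<open>n\<close> instead of the ancestor. The value 0 for vertices
  with fewer than \<open>n\<close> ancestors matches the value 0 that the shift takes at the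
  root.\<close>

definition ancestor_weight :: "('v \<Rightarrow> complex) \<Rightarrow> nat \<Rightarrow> 'v \<Rightarrow> complex" where
  "ancestor_weight lam n v =
     (if \<forall>i<n. (par E ^^ i) v \<in> nonroots V E then \<Prod>j<n. lam ((par E ^^ j) v) else 0)"

lemma path_weight_eq:
  assumes "u \<in> V" "v \<in> Chi_n E n u"
  shows "path_weight E lam u v = ancestor_weight lam n v"
proof -
  have "(THE n. v \<in> Chi_n E n u) = n"
    using assms generation_unique by blast
  then show ?thesis
    using assms by (simp add: path_weight_def ancestor_weight_def Chi_n_iff)
qed

lemma ancestor_weight_Suc:
  "ancestor_weight lam (Suc n) v =
    (if v \<in> nonroots V E then lam v * ancestor_weight lam n (par E v) else 0)"
  unfolding ancestor_weight_def All_less_Suc2 prod.lessThan_Suc_shift funpow_Suc_right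
  by auto

lemma shift_map_power:
  "(shift_map V E lam ^^ n) f v = ancestor_weight lam n v * f ((par E ^^ n) v)"
proof (induction n arbitrary: v)
  case (Suc n)
  have "(shift_map V E lam ^^ Suc n) f v = shift_map V E lam ((shift_map V E lam ^^ n) f) v"
    by simp
  also have "\<dots> = (if v \<in> nonroots V E then lam v * (shift_map V E lam ^^ n) f (par E v) else 0)"
    by (rule shift_map_def[THEN fun_cong])
  also have "\<dots> = ancestor_weight lam (Suc n) v * f ((par E ^^ Suc n) v)"
    unfolding Suc ancestor_weight_Suc funpow_Suc_right by simp
  finally show ?case .
qed (simp add: ancestor_weight_def)

text \<open>A vertex with at least \<open>n\<close> ancestors has exactly one \<open>n\<close>-th
  ancestor, so sums over such vertices can be regrouped by it.\<close>

lemma bij_betw_descendants: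
  "bij_betw snd (SIGMA u:V. Chi_n E n u) {v \<in> V. \<forall>i<n. (par E ^^ i) v \<in> nonroots V E}"
proof (rule bij_betw_byWitness[where f' = "\<lambda>v. ((par E ^^ n) v, v)"])
  show "snd ` (SIGMA u:V. Chi_n E n u) \<subseteq> {v \<in> V. \<forall>i<n. (par E ^^ i) v \<in> nonroots V E}"
    using Chi_n_subset_V by (fastforce simp: Chi_n_iff)
  show "(\<lambda>v. ((par E ^^ n) v, v)) ` {v \<in> V. \<forall>i<n. (par E ^^ i) v \<in> nonroots V E}
      \<subseteq> (SIGMA u:V. Chi_n E n u)"
    using Chi_n_ancestor_in_V by (fastforce simp: Chi_n_iff)
qed (auto simp: Chi_n_iff)

end

section \<open>Square summable functions and powers of bounded operators\<close>

lemma has_sum_sum_finite: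
  fixes f :: "'i \<Rightarrow> 'a \<Rightarrow> 'b :: topological_comm_monoid_add"
  assumes "\<And>i. i \<in> I \<Longrightarrow> (f i has_sum s i) A"
  shows "((\<lambda>x. \<Sum>i\<in>I. f i x) has_sum (\<Sum>i\<in>I. s i)) A"
  using assms by (induction I rule: infinite_finite_induct) (auto intro: has_sum_add)

lemma ell2_norm_sq: "(ell2_norm V f)\<^sup>2 = (\<Sum>\<^sub>\<infinity>v\<in>V. (cmod (f v))\<^sup>2)"
  by (simp add: ell2_norm_def infsum_nonneg)

lemma basis_vec_in_ell2: "u \<in> V \<Longrightarrow> basis_vec u \<in> ell2 V"
proof -
  assume "u \<in> V"
  moreover have "(\<lambda>v. (cmod (basis_vec u v))\<^sup>2) summable_on V \<longleftrightarrow>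
      (\<lambda>v. (cmod (basis_vec u v))\<^sup>2) summable_on (V \<inter> {u})"
    by (rule summable_on_cong_neutral) auto
  ultimately show ?thesis by (auto simp: ell2_def indicator_def)
qed

lemma op_power_add: "op_power A (m + n) f = op_power A n (op_power A m f)"
  by (simp add: op_power_def funpow_add add.commute[of m])

lemma op_power_in_ell2:
  assumes "A \<in> bounded_ops V" "f \<in> ell2 V"
  shows "op_power A n f \<in> ell2 V"
  using assms by (induction n) (auto simp: op_power_def bounded_ops_def)

lemma op_power_weighted_shift: "op_power (weighted_shift V E lam) n = shift_map V E lam ^^ n"
  by (simp add: op_power_def weighted_shift_def)

section \<open>Norms of the powers of the shift\<close>

context directed_tree
begin

lemma norm_power_basis_vec:
  assumes "u \<in> V"
  shows "(ell2_norm V (op_power (weighted_shift V E lam) n (basis_vec u)))\<^sup>2 =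
    (\<Sum>\<^sub>\<infinity>v\<in>Chi_n E n u. (cmod (ancestor_weight lam n v))\<^sup>2)"
proof -
  \<comment> \<open>This puts the support of the \<open>n\<close>-th power at
    \<open>basis_vec u\<close> inside \<open>V\<close>, also for \<open>n = 0\<close>, where the
    condition only says \<open>v = u\<close>.\<close>
  have "v \<in> V" if "\<forall>i<n. (par E ^^ i) v \<in> nonroots V E" "(par E ^^ n) v = u" for v
    using Chi_n_subset_V[OF assms] that Chi_n_iff[of v n u] by blast
  then show ?thesis
    unfolding ell2_norm_sq op_power_weighted_shift shift_map_power
    by (intro infsum_cong_neutral)
      (auto simp: Chi_n_iff ancestor_weight_def indicator_def split: if_splits)
qed

text \<open>The squared norm is a sum over \<open>V\<close>; grouping its terms by
  \<open>n\<close>-th ancestor \<open>u\<close> lets \<open>f u\<close> factor out of each group,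
  and what remains is the squared norm for \<open>basis_vec u\<close>.\<close>

lemma norm_power_has_sum:
  assumes "weighted_shift V E lam \<in> bounded_ops V" "f \<in> ell2 V"
  shows "((\<lambda>u. (cmod (f u))\<^sup>2 * (ell2_norm V (op_power (weighted_shift V E lam) n (basis_vec u)))\<^sup>2)
    has_sum (ell2_norm V (op_power (weighted_shift V E lam) n f))\<^sup>2) V"
proof -
  define D where "D = {v \<in> V. \<forall>i<n. (par E ^^ i) v \<in> nonroots V E}"
  define w where "w v = (cmod (ancestor_weight lam n v))\<^sup>2" for v
  define N where "N = (ell2_norm V (op_power (weighted_shift V E lam) n f))\<^sup>2"
  have "((\<lambda>v. w v * (cmod (f ((par E ^^ n) v)))\<^sup>2) has_sum N) V"
    using op_power_in_ell2[OF assms, of n]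
    unfolding N_def ell2_norm_sq ell2_def op_power_weighted_shift shift_map_power w_def
    by (auto simp: norm_mult power_mult_distrib intro: has_sum_infsum)
  also have "?this \<longleftrightarrow> ((\<lambda>v. w v * (cmod (f ((par E ^^ n) v)))\<^sup>2) has_sum N) D"
    by (rule has_sum_cong_neutral) (auto simp: D_def w_def ancestor_weight_def)
  also have "\<dots> \<longleftrightarrow> ((\<lambda>p. w (snd p) * (cmod (f ((par E ^^ n) (snd p))))\<^sup>2) has_sum N)
      (SIGMA u:V. Chi_n E n u)"
    using has_sum_reindex_bij_betw[OF bij_betw_descendants[of n, folded D_def]] by (rule sym)
  \<comment> \<open>On the pairs summed over, the \<open>n\<close>-th ancestor of \<open>v\<close>
    is \<open>u\<close>.\<close>
  also have "\<dots> \<longleftrightarrow> ((\<lambda>(u, v). w v * (cmod (f u))\<^sup>2) has_sum N) (SIGMA u:V. Chi_n E n u)"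
    by (rule has_sum_cong) (auto simp: Chi_n_iff)
  finally have sum: "((\<lambda>(u, v). w v * (cmod (f u))\<^sup>2) has_sum N) (SIGMA u:V. Chi_n E n u)" .
  then have summable: "(\<lambda>(u, v). w v * (cmod (f u))\<^sup>2) summable_on (SIGMA u:V. Chi_n E n u)"
    by (auto simp: summable_on_def)
  \<comment> \<open>Summability over the pairs permits summing first over the descendants of each
    \<open>u\<close>, then over \<open>u\<close>.\<close>
  have "(\<lambda>u. \<Sum>\<^sub>\<infinity>v\<in>Chi_n E n u. w v * (cmod (f u))\<^sup>2) summable_on V"
    using summable_on_Sigma_banach[OF summable] by simp
  moreover have "(\<Sum>\<^sub>\<infinity>u\<in>V. \<Sum>\<^sub>\<infinity>v\<in>Chi_n E n u. w v * (cmod (f u))\<^sup>2) = N"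
    using infsum_Sigma'_banach[OF summable] sum by (simp add: infsumI)
  ultimately have "((\<lambda>u. \<Sum>\<^sub>\<infinity>v\<in>Chi_n E n u. w v * (cmod (f u))\<^sup>2) has_sum N) V"
    using has_sum_infsum by fastforce
  moreover have "(\<Sum>\<^sub>\<infinity>v\<in>Chi_n E n u. w v * (cmod (f u))\<^sup>2) =
      (cmod (f u))\<^sup>2 * (ell2_norm V (op_power (weighted_shift V E lam) n (basis_vec u)))\<^sup>2"
    if "u \<in> V" for u
    using that by (simp add: norm_power_basis_vec infsum_cmult_right' w_def mult.commute)
  ultimately show ?thesis
    unfolding N_def by (simp cong: has_sum_cong)
qed

text \<open>By \<open>norm_power_has_sum\<close> the alternating sum for \<open>f\<close> is the sum
  over \<open>u\<close> of those for the basis vectors, with nonnegative coefficients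
  \<open>(cmod (f u))\<^sup>2\<close>.\<close>

lemma alternating_sum_nonpos:
  assumes bounded: "weighted_shift V E lam \<in> bounded_ops V" and f: "f \<in> ell2 V"
    and basis: "\<And>u. u \<in> V \<Longrightarrow> (\<Sum>j=0..n. (-1) ^ j * real (n choose j) *
      (ell2_norm V (op_power (weighted_shift V E lam) j (basis_vec u)))\<^sup>2) \<le> 0"
  shows "(\<Sum>j=0..n. (-1) ^ j * real (n choose j) *
    (ell2_norm V (op_power (weighted_shift V E lam) j f))\<^sup>2) \<le> 0"
proof (rule has_sum_mono)
  show "((\<lambda>u. \<Sum>j=0..n. (-1) ^ j * real (n choose j) * ((cmod (f u))\<^sup>2 *
      (ell2_norm V (op_power (weighted_shift V E lam) j (basis_vec u)))\<^sup>2))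
    has_sum (\<Sum>j=0..n. (-1) ^ j * real (n choose j) *
      (ell2_norm V (op_power (weighted_shift V E lam) j f))\<^sup>2)) V"
    by (intro has_sum_sum_finite has_sum_cmult_right norm_power_has_sum bounded f)
  show "((\<lambda>u. 0) has_sum (0 :: real)) V" by simp
next
  fix u assume "u \<in> V"
  have "(\<Sum>j=0..n. (-1) ^ j * real (n choose j) * ((cmod (f u))\<^sup>2 *
      (ell2_norm V (op_power (weighted_shift V E lam) j (basis_vec u)))\<^sup>2)) =
    (cmod (f u))\<^sup>2 * (\<Sum>j=0..n. (-1) ^ j * real (n choose j) *
      (ell2_norm V (op_power (weighted_shift V E lam) j (basis_vec u)))\<^sup>2)"
    by (simp add: sum_distrib_left mult_ac)
  also have "\<dots> \<le> 0"
    using basis[OF \<open>u \<in> V\<close>] by (intro mult_nonneg_nonpos) auto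
  finally show "(\<Sum>j=0..n. (-1) ^ j * real (n choose j) * ((cmod (f u))\<^sup>2 *
      (ell2_norm V (op_power (weighted_shift V E lam) j (basis_vec u)))\<^sup>2)) \<le> 0" .
qed

end

theorem theorem7p1p4:
  fixes V :: "'v set" and E :: "('v \<times> 'v) set" and lam :: "'v \<Rightarrow> complex"
  assumes tree: "directed_tree V E"
    and bounded: "weighted_shift V E lam \<in> bounded_ops V"
  defines "S \<equiv> weighted_shift V E lam"
  defines "cond_i \<equiv> completely_hyperexpansive V S"
    and "cond_ii \<equiv> (\<forall>u\<in>V. completely_alternating
           (\<lambda>n. \<Sum>\<^sub>\<infinity>v\<in>Chi_n E n u. (cmod (path_weight E lam u v))\<^sup>2))"
    and "cond_iii \<equiv> (\<forall>u\<in>V. completely_alternating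
           (\<lambda>n. (ell2_norm V (op_power S n (basis_vec u)))\<^sup>2))"
    and "cond_iv \<equiv> (\<forall>n\<ge>1. \<forall>u\<in>V. (\<Sum>j=0..n. (-1) ^ j * real (n choose j) *
           (ell2_norm V (op_power S j (basis_vec u)))\<^sup>2) \<le> 0)"
  shows "(cond_i \<longleftrightarrow> cond_ii) \<and> (cond_ii \<longleftrightarrow> cond_iii) \<and> (cond_iii \<longleftrightarrow> cond_iv)"
proof -
  interpret directed_tree V E by (rule tree)
  \<comment> \<open>The sequences in \<open>cond_ii\<close> and \<open>cond_iii\<close> are equal
    term by term.\<close>
  have "(\<Sum>\<^sub>\<infinity>v\<in>Chi_n E n u. (cmod (path_weight E lam u v))\<^sup>2) =
      (ell2_norm V (op_power S n (basis_vec u)))\<^sup>2" if "u \<in> V" for u n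
    using that by (simp add: S_def norm_power_basis_vec path_weight_eq cong: infsum_cong)
  then have "cond_ii \<longleftrightarrow> cond_iii"
    by (simp add: cond_ii_def cond_iii_def)
  moreover have "cond_iii" if "cond_i"
    unfolding cond_iii_def
  proof
    fix u assume "u \<in> V"
    then show "completely_alternating (\<lambda>n. (ell2_norm V (op_power S n (basis_vec u)))\<^sup>2)"
      by (intro bspec[OF that[unfolded cond_i_def completely_hyperexpansive_def, THEN conjunct2]]
          basis_vec_in_ell2)
  qed
  moreover have "cond_iv" if "cond_iii"
    unfolding cond_iv_def
  proof (intro allI impI ballI)
    fix n :: nat and u assume "n \<ge> 1" "u \<in> V"
    then show "(\<Sum>j=0..n. (-1) ^ j * real (n choose j) *
        (ell2_norm V (op_power S j (basis_vec u)))\<^sup>2) \<le> 0"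
      using that by (intro completely_alternating_0) (simp_all add: cond_iii_def)
  qed
  moreover have "cond_i" if iv: "cond_iv"
  proof -
    have "(\<Sum>j=0..n. (-1) ^ j * real (n choose j) * (ell2_norm V (op_power S (m + j) h))\<^sup>2) \<le> 0"
      if "n \<ge> 1" "h \<in> ell2 V" for n m h
      \<comment> \<open>The index shift by \<open>m\<close> is absorbed into the vector: the
        unshifted inequality is applied to the \<open>m\<close>-th power of the shift at
        \<open>h\<close>, which lies in \<open>ell2 V\<close> by boundedness.\<close>
      unfolding op_power_add S_def
    proof (rule alternating_sum_nonpos[OF bounded op_power_in_ell2[OF bounded that(2)]])
      fix u assume "u \<in> V"
      then show "(\<Sum>j=0..n. (-1) ^ j * real (n choose j) *
          (ell2_norm V (op_power (weighted_shift V E lam) j (basis_vec u)))\<^sup>2) \<le> 0"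
        using iv \<open>n \<ge> 1\<close> unfolding cond_iv_def S_def by blast
    qed
    then show ?thesis
      using bounded
      by (simp add: cond_i_def completely_hyperexpansive_def completely_alternating_def S_def)
  qed
  ultimately show ?thesis by blast
qed

end
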